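(* Let $S=(X,\mathbb{A},\mathbb{R})$ be an axiomatic formal system whose set of formulas $X$ is endowed with a negation operator $\neg: X\to X$. If $S$ satisfies joint consistency and the conjunctive property, and if $\vdash_S$ is explosive, then $\vdash_S^P$ is paraconsistent.
   Context: For a positive integer $n$ and a non-empty set $X$, let $\wp^{(n)}(X)=\{A\subseteq X: |A|=n\}$. An inference rule of degree $n$ on $X$ is a relation $R\subseteq \wp^{(n)}(X)\times X$; if $(\{x_1,\dots,x_n\},x)\in R$, then $x$ is an immediate consequence of $\{x_1,\dots,x_n\}$ by $R$. For a family $\mathbb{R}$ of inference rules, $x$ is an immediate consequence of $\{x_1,\dots,x_n\}$ if it is so by some $R\in\mathbb{R}$. An axiomatic formal system is a triple $S=(X,\mathbb{A},\mathbb{R})$ where $X$ is a non-empty set (of formulas), $\mathbb{A}\subseteq X$ (the axioms), and $\mathbb{R}$ is a finite family of inference rules on $X$ (each of some positive degree). For $A\subseteq X$, an $S$-deduction from $A$ is a finite (non-empty) sequence $a_1,\dots,a_n$ of elements of $X$ such that for each $1\le i\le n$: $a_i\in A$, or $a_i\in\mathbb{A}$, or $a_i$ is an immediate consequence of a set of formulas preceding it in the sequence. Write $A\vdash_S a$ if there is an $S$-deduction $a_1,\dots,a_n$ from $A$ with $a_n=a$, and $Cn_S(A)=\{a\in X: A\vdash_S a\}$. The set $A$ is $S$-consistent if $Cn_S(A)\neq X$, and $S$-inconsistent otherwise. Standing assumption: in every axiomatic formal system, $\emptyset$ is $S$-consistent. A paradeduction in $S$ from $A\subseteq X$ is a finite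 (non-empty) sequence of pairs $(A_1,a_1),\dots,(A_n,a_n)$ with $A_i\subseteq X$ and $a_i\in X$ such that: (1) $A_i$ is $S$-consistent for all $1\le i\le n$; (2) for each $1\le i\le n$ one of the following holds: (a) $a_i\in A$ and $A_i=\{a_i\}$; (b) $a_i\in\mathbb{A}$ and $A_i=\emptyset$; (c) $a_i$ is an immediate consequence of a set of preceding formulas $\{a_{i_1},\dots,a_{i_k}\}$ (with $i_1,\dots,i_k<i$) and $A_i=\bigcup_{j=1}^k A_{i_j}$. Write $A\vdash_S^P a$ if there is a paradeduction $(A_1,a_1),\dots,(A_n,a_n)$ in $S$ from $A$ with $a_n=a$. Let $\neg:X\to X$ be an operator representing negation (no further properties are assumed of it). A consequence relation $\vdash$ between subsets of $X$ and elements of $X$ (here $\vdash_S$ or $\vdash_S^P$) is explosive if for all $A\subseteq X$: if there is $x\in X$ such that $A\vdash x$ and $A\vdash\neg x$, then $A\vdash y$ for all $y\in X$. Otherwise it is paraconsistent. The system $S$ satisfies joint consistency if there is $x\in X$ such that $\{x\}$ and $\{\neg x\}$ are both $S$-consistent while $\{x,\neg x\}$ is $S$-inconsistent. The system $S$ satisfies the conjunctive property if for all $x,y\in X$ there exists $z\in X$ such that $Cn_S(\{x,y\})=Cn_S(\{z\})$. *)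

theory Defs
  imports Main "HOL-Library.FuncSet" "HOL-Library.Ramsey"
begin

type_synonym 'a rule = "('a set \<times> 'a) set"

text \<open>\<open>nsets X n\<close> is the library's set of all \<open>n\<close>-element subsets of \<open>X\<close>.\<close>

definition inference_rule :: "nat \<Rightarrow> 'a set \<Rightarrow> 'a rule \<Rightarrow> bool" where
  "inference_rule n X R \<longleftrightarrow> R \<subseteq> nsets X n \<times> X"

record 'a formal_system =
  formulas :: "'a set"
  axioms :: "'a set"
  rules :: "'a rule set"

definition immediate_consequence :: "'a formal_system \<Rightarrow> 'a set \<Rightarrow> 'a \<Rightarrow> bool" where
  "immediate_consequence S P x \<longleftrightarrow> (\<exists>R\<in>rules S. (P, x) \<in> R)"

definition deduction :: "'a formal_system \<Rightarrow> 'a set \<Rightarrow> 'a list \<Rightarrow> bool" where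
  "deduction S A as \<longleftrightarrow>
     as \<noteq> [] \<and> set as \<subseteq> formulas S \<and>
     (\<forall>i<length as.
        as ! i \<in> A \<or>
        as ! i \<in> axioms S \<or>
        (\<exists>P \<subseteq> set (take i as). immediate_consequence S P (as ! i)))"

definition deducible :: "'a formal_system \<Rightarrow> 'a set \<Rightarrow> 'a \<Rightarrow> bool" where
  "deducible S A a \<longleftrightarrow> (\<exists>as. deduction S A as \<and> last as = a)"

definition Cn :: "'a formal_system \<Rightarrow> 'a set \<Rightarrow> 'a set" where
  "Cn S A = {a \<in> formulas S. deducible S A a}"

definition consistent :: "'a formal_system \<Rightarrow> 'a set \<Rightarrow> bool" where
  "consistent S A \<longleftrightarrow> Cn S A \<noteq> formulas S"

abbreviation inconsistent :: "'a formal_system \<Rightarrow> 'a set \<Rightarrow> bool" where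
  "inconsistent S A \<equiv> \<not> consistent S A"

text \<open>The last clause is the standing assumption that the empty set is consistent in every
  axiomatic formal system.\<close>

definition axiomatic_formal_system :: "'a formal_system \<Rightarrow> bool" where
  "axiomatic_formal_system S \<longleftrightarrow>
     formulas S \<noteq> {} \<and>
     axioms S \<subseteq> formulas S \<and>
     finite (rules S) \<and>
     (\<forall>R\<in>rules S. \<exists>n>0. inference_rule n (formulas S) R) \<and>
     consistent S {}"

text \<open>In the rule case, \<open>J\<close> is the set of indices \<open>{i\<^sub>1, \<dots>, i\<^sub>k}\<close> of the premises. Distinct indices
  may carry the same formula; the supporting sets of all of them are then collected.\<close>

definition paradeduction :: "'a formal_system \<Rightarrow> 'a set \<Rightarrow> ('a set \<times> 'a) list \<Rightarrow> bool" where
  "paradeduction S A ps \<longleftrightarrow>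
     ps \<noteq> [] \<and> set ps \<subseteq> Pow (formulas S) \<times> formulas S \<and>
     (\<forall>i<length ps.
        consistent S (fst (ps ! i)) \<and>
        (snd (ps ! i) \<in> A \<and> fst (ps ! i) = {snd (ps ! i)} \<or>
         snd (ps ! i) \<in> axioms S \<and> fst (ps ! i) = {} \<or>
         (\<exists>J \<subseteq> {..<i}.
            immediate_consequence S ((\<lambda>j. snd (ps ! j)) ` J) (snd (ps ! i)) \<and>
            fst (ps ! i) = (\<Union>j\<in>J. fst (ps ! j)))))"

definition paradeducible :: "'a formal_system \<Rightarrow> 'a set \<Rightarrow> 'a \<Rightarrow> bool" where
  "paradeducible S A a \<longleftrightarrow> (\<exists>ps. paradeduction S A ps \<and> snd (last ps) = a)"

definition explosive :: "'a set \<Rightarrow> ('a \<Rightarrow> 'a) \<Rightarrow> ('a set \<Rightarrow> 'a \<Rightarrow> bool) \<Rightarrow> bool" where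
  "explosive X neg entails \<longleftrightarrow>
     (\<forall>A \<subseteq> X. (\<exists>x\<in>X. entails A x \<and> entails A (neg x)) \<longrightarrow> (\<forall>y\<in>X. entails A y))"

definition paraconsistent :: "'a set \<Rightarrow> ('a \<Rightarrow> 'a) \<Rightarrow> ('a set \<Rightarrow> 'a \<Rightarrow> bool) \<Rightarrow> bool" where
  "paraconsistent X neg entails \<longleftrightarrow> \<not> explosive X neg entails"

definition joint_consistency :: "'a formal_system \<Rightarrow> ('a \<Rightarrow> 'a) \<Rightarrow> bool" where
  "joint_consistency S neg \<longleftrightarrow>
     (\<exists>x\<in>formulas S. consistent S {x} \<and> consistent S {neg x} \<and> inconsistent S {x, neg x})"

definition conjunctive_property :: "'a formal_system \<Rightarrow> bool" where
  "conjunctive_property S \<longleftrightarrow>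
     (\<forall>x\<in>formulas S. \<forall>y\<in>formulas S. \<exists>z\<in>formulas S. Cn S {x, y} = Cn S {z})"

end

theory Submission imports Defs begin

text \<open>
  Let \<open>x\<close> be a formula such that \<open>{x}\<close> and \<open>{neg x}\<close> are consistent while \<open>{x, neg x}\<close> is not;
  the set \<open>{x, neg x}\<close> then witnesses that paradeducibility is not explosive. Clearly it
  paradeduces both \<open>x\<close> and \<open>neg x\<close>. By the conjunctive property some single formula \<open>z\<close> has
  the same consequences as \<open>{x, neg x}\<close>, that is, all formulas; it condenses the whole
  inconsistency of \<open>{x, neg x}\<close> into one formula.

  This \<open>z\<close> is not paradeducible. The supports carried along a paradeduction are consistent
  sets of assumptions, and each formula is an ordinary consequence of its support
  (\<open>paradeducible_consistent_support\<close>). But a set having \<open>z\<close> among its consequences has, by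
  transitivity (\<open>Cn_cut\<close>), all formulas among them, so it is inconsistent and cannot be a support.
\<close>

lemma Cn_subset_formulas: "Cn S A \<subseteq> formulas S"
  by (auto simp: Cn_def)

lemma mem_Cn_if_assumption_or_axiom:
  assumes "a \<in> formulas S" "a \<in> A \<or> a \<in> axioms S"
  shows "a \<in> Cn S A"
proof -
  have "deduction S A [a]" using assms by (auto simp: deduction_def)
  then show ?thesis using assms by (force simp: Cn_def deducible_def)
qed

lemma deduction_append:
  assumes "deduction S A as" "deduction S A bs"
  shows "deduction S A (as @ bs)"
  unfolding deduction_def
proof (intro conjI allI impI)
  show "as @ bs \<noteq> []" "set (as @ bs) \<subseteq> formulas S"
    using assms by (auto simp: deduction_def)
next
  fix i assume i: "i < length (as @ bs)"
  show "(as @ bs) ! i \<in> A \<or> (as @ bs) ! i \<in> axioms S \<or>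
        (\<exists>P \<subseteq> set (take i (as @ bs)). immediate_consequence S P ((as @ bs) ! i))"
  proof (cases "i < length as")
    case True
    then show ?thesis using assms(1) by (simp add: deduction_def nth_append)
  next
    case False
    then have "i - length as < length bs" using i by simp
    then have "bs ! (i - length as) \<in> A \<or> bs ! (i - length as) \<in> axioms S \<or>
        (\<exists>P \<subseteq> set (take (i - length as) bs).
           immediate_consequence S P (bs ! (i - length as)))"
      using assms(2) by (simp add: deduction_def)
    then show ?thesis using False by (auto simp: nth_append)
  qed
qed

lemma deduction_snoc:
  assumes "deduction S A as" "a \<in> formulas S"
    and "P \<subseteq> set as" "immediate_consequence S P a"
  shows "deduction S A (as @ [a])"
  using assms by (auto simp: deduction_def nth_append less_Suc_eq)

lemma deduction_containing_finite_set:
  assumes "finite P" "P \<noteq> {}" "P \<subseteq> Cn S A"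
  shows "\<exists>as. deduction S A as \<and> P \<subseteq> set as"
  using assms
proof (induction rule: finite_ne_induct)
  case (singleton p)
  then obtain as where "deduction S A as" "last as = p"
    by (auto simp: Cn_def deducible_def)
  then show ?case by (auto simp: deduction_def intro!: exI[of _ as])
next
  case (insert p P)
  then obtain as where as: "deduction S A as" "P \<subseteq> set as" by auto
  from insert.prems obtain bs where bs: "deduction S A bs" "last bs = p"
    by (auto simp: Cn_def deducible_def)
  then have "p \<in> set bs" by (auto simp: deduction_def)
  with as bs(1) deduction_append[OF as(1) bs(1)] show ?case by fastforce
qed

lemma immediate_consequenceD:
  assumes "axiomatic_formal_system S" "immediate_consequence S P a"
  shows "finite P" "P \<noteq> {}" "a \<in> formulas S"
proof -
  obtain R n where "(P, a) \<in> R" "n > 0" "R \<subseteq> nsets (formulas S) n \<times> formulas S"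
    using assms
    by (fastforce simp: axiomatic_formal_system_def immediate_consequence_def inference_rule_def)
  then show "finite P" "P \<noteq> {}" "a \<in> formulas S" by (auto simp: nsets_def)
qed

text \<open>Every rule has a finite positive degree, so deductions of its premises can be concatenated
  into a single deduction.\<close>

lemma Cn_closed_under_rules:
  assumes S: "axiomatic_formal_system S"
    and P: "P \<subseteq> Cn S A" "immediate_consequence S P a"
  shows "a \<in> Cn S A"
proof -
  note ic = immediate_consequenceD[OF S P(2)]
  obtain as where "deduction S A as" "P \<subseteq> set as"
    using deduction_containing_finite_set[OF ic(1,2) P(1)] by blast
  then have "deduction S A (as @ [a])" using deduction_snoc ic(3) P(2) by metis
  then show ?thesis using ic(3) by (force simp: Cn_def deducible_def)
qed

text \<open>\<open>Cn S B\<close> contains the axioms and is closed under the rules, so no deduction that starts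
  inside it can leave it.\<close>

lemma Cn_cut:
  assumes S: "axiomatic_formal_system S" and AB: "A \<subseteq> Cn S B"
  shows "Cn S A \<subseteq> Cn S B"
proof
  fix a assume "a \<in> Cn S A"
  then obtain as where as: "deduction S A as" "last as = a"
    by (auto simp: Cn_def deducible_def)
  have "as ! i \<in> Cn S B" if "i < length as" for i
    using that
  proof (induction i rule: less_induct)
    case (less i)
    then have "set (take i as) \<subseteq> Cn S B" by (auto simp: in_set_conv_nth)
    moreover have "as ! i \<in> formulas S" using as(1) less.prems
      by (auto simp: deduction_def)
    moreover have "as ! i \<in> A \<or> as ! i \<in> axioms S \<or>
        (\<exists>P \<subseteq> set (take i as). immediate_consequence S P (as ! i))"
      using as(1) less.prems by (simp add: deduction_def)
    ultimately show ?case
      using AB mem_Cn_if_assumption_or_axiom Cn_closed_under_rules[OF S] by (meson subset_iff)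
  qed
  then show "a \<in> Cn S B" using as by (auto simp: deduction_def last_conv_nth)
qed

lemma Cn_mono:
  assumes "axiomatic_formal_system S" "A \<subseteq> B" "B \<subseteq> formulas S"
  shows "Cn S A \<subseteq> Cn S B"
  using assms mem_Cn_if_assumption_or_axiom by (metis Cn_cut subset_iff)

lemma paradeduction_nth:
  assumes S: "axiomatic_formal_system S" and ps: "paradeduction S A ps"
    and "i < length ps"
  shows "fst (ps ! i) \<subseteq> A \<and> snd (ps ! i) \<in> Cn S (fst (ps ! i))"
  using \<open>i < length ps\<close>
proof (induction i rule: less_induct)
  case (less i)
  have "ps ! i \<in> Pow (formulas S) \<times> formulas S"
    using ps less.prems unfolding paradeduction_def by (meson nth_mem subsetD)
  then have form: "fst (ps ! i) \<subseteq> formulas S" "snd (ps ! i) \<in> formulas S"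
    by (auto simp: mem_Times_iff)
  consider "snd (ps ! i) \<in> A" "fst (ps ! i) = {snd (ps ! i)}"
    | "snd (ps ! i) \<in> axioms S" "fst (ps ! i) = {}"
    | J where "J \<subseteq> {..<i}"
        "immediate_consequence S ((\<lambda>j. snd (ps ! j)) ` J) (snd (ps ! i))"
        "fst (ps ! i) = (\<Union>j\<in>J. fst (ps ! j))"
    using ps less.prems unfolding paradeduction_def by blast
  then show ?case
  proof cases
    case 1
    then show ?thesis using form by (simp add: mem_Cn_if_assumption_or_axiom)
  next
    case 2
    then show ?thesis using form by (simp add: mem_Cn_if_assumption_or_axiom)
  next
    case 3
    have IH: "fst (ps ! j) \<subseteq> A" "snd (ps ! j) \<in> Cn S (fst (ps ! j))" if "j \<in> J" for j
      using less that 3(1) by force+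
    have "snd (ps ! j) \<in> Cn S (fst (ps ! i))" if "j \<in> J" for j
    proof -
      have "fst (ps ! j) \<subseteq> fst (ps ! i)" using that 3(3) by blast
      then show ?thesis using IH(2)[OF that] Cn_mono[OF S _ form(1)] by blast
    qed
    then have "snd (ps ! i) \<in> Cn S (fst (ps ! i))"
      using Cn_closed_under_rules[OF S _ 3(2)] by blast
    then show ?thesis using IH(1) 3(3) by blast
  qed
qed

text \<open>A paradeduction is an ordinary deduction annotated with the assumptions on which each
  formula rests; its consistency requirement applies in particular to the last annotation.\<close>

lemma paradeducible_consistent_support:
  assumes "axiomatic_formal_system S" "paradeducible S A a"
  obtains B where "B \<subseteq> A" "consistent S B" "a \<in> Cn S B"
proof -
  from assms(2) obtain ps where ps: "paradeduction S A ps" "snd (last ps) = a"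
    by (auto simp: paradeducible_def)
  let ?n = "length ps - 1"
  have n: "?n < length ps" "ps ! ?n = last ps"
    using ps(1) by (auto simp: paradeduction_def last_conv_nth)
  then have "consistent S (fst (last ps))"
    using ps(1) unfolding paradeduction_def by metis
  then show thesis using that paradeduction_nth[OF assms(1) ps(1) n(1)] n(2) ps(2) by auto
qed

lemma paradeducible_assumption:
  assumes "a \<in> A" "a \<in> formulas S" "consistent S {a}"
  shows "paradeducible S A a"
proof -
  have "paradeduction S A [({a}, a)]" using assms by (auto simp: paradeduction_def)
  then show ?thesis by (force simp: paradeducible_def)
qed

lemma inconsistent_if_Cn_full:
  assumes "axiomatic_formal_system S" "Cn S {z} = formulas S" "z \<in> Cn S A"
  shows "inconsistent S A"
  using Cn_cut[of S "{z}" A] Cn_subset_formulas[of S A] assms by (auto simp: consistent_def)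

theorem theorem5p1:
  fixes S :: "'a formal_system" and neg :: "'a \<Rightarrow> 'a"
  assumes "axiomatic_formal_system S"
    and "neg \<in> formulas S \<rightarrow> formulas S"
    and "joint_consistency S neg"
    and "conjunctive_property S"
    and "explosive (formulas S) neg (deducible S)"
  shows "paraconsistent (formulas S) neg (paradeducible S)"
proof -
  note S = assms(1)
  obtain x where x: "x \<in> formulas S" "consistent S {x}" "consistent S {neg x}"
      "inconsistent S {x, neg x}"
    using assms(3) by (auto simp: joint_consistency_def)
  have nx: "neg x \<in> formulas S" using assms(2) x(1) by auto
  obtain z where z: "z \<in> formulas S" "Cn S {x, neg x} = Cn S {z}"
    using assms(4) x(1) nx unfolding conjunctive_property_def by blast
  then have full: "Cn S {z} = formulas S" using x(4) by (simp add: consistent_def)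
  have "\<not> paradeducible S {x, neg x} z"
  proof
    assume "paradeducible S {x, neg x} z"
    then obtain B where B: "B \<subseteq> {x, neg x}" "consistent S B" "z \<in> Cn S B"
      using paradeducible_consistent_support[OF S] by metis
    then show False using inconsistent_if_Cn_full[OF S full] by blast
  qed
  moreover have "paradeducible S {x, neg x} x" "paradeducible S {x, neg x} (neg x)"
    using x nx by (auto intro: paradeducible_assumption)
  moreover have "{x, neg x} \<subseteq> formulas S" using x(1) nx by simp
  ultimately show ?thesis
    using x(1) z(1) unfolding paraconsistent_def explosive_def by blast
qed

end
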